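(* For any $2n\times 2n$ real symplectic matrix $S$, there exist a $2n\times 2n$ orthogonal symplectic matrix $O$ (a real matrix that is both orthogonal and symplectic), an $n\times n$ real invertible matrix $G$, and $n$ unique (up to order and signs) real numbers $\theta_1,\dots,\theta_n$ such that $$S=O\begin{bmatrix} Ch & Sh \\ Sh & Ch \end{bmatrix}\begin{bmatrix} G & 0 \\ 0 & G^{-T} \end{bmatrix},$$ where $Ch=\operatorname{diag}(\cosh\theta_1,\dots,\cosh\theta_n)$ and $Sh=\operatorname{diag}(\sinh\theta_1,\dots,\sinh\theta_n)$.
   Context: A real symplectic matrix is $S\in\mathbb{R}^{2n\times2n}$ with $S^TJ_nS=J_n$, where $J_n=\begin{bmatrix} 0 & I_n \\ -I_n & 0 \end{bmatrix}$. $G^{-T}=(G^{-1})^T$. *)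

theory Defs
  imports "HOL-Analysis.Analysis"
begin

text \<open>
  The index type \<open>'n + 'n\<close> plays the role of \<open>{1, \<dots>, 2n}\<close> with \<open>n = CARD('n)\<close>: \<open>Inl i\<close> is the
  \<open>i\<close>-th index of the first half and \<open>Inr i\<close> the \<open>i\<close>-th index of the second half.
\<close>

definition block_matrix ::
  "'a ^ 'n ^ 'n \<Rightarrow> 'a ^ 'n ^ 'n \<Rightarrow> 'a ^ 'n ^ 'n \<Rightarrow> 'a ^ 'n ^ 'n \<Rightarrow> 'a ^ ('n::finite + 'n) ^ ('n + 'n)"
  where "block_matrix A B C D =
    (\<chi> r c. case r of
       Inl i \<Rightarrow> (case c of Inl j \<Rightarrow> A $ i $ j | Inr j \<Rightarrow> B $ i $ j)
     | Inr i \<Rightarrow> (case c of Inl j \<Rightarrow> C $ i $ j | Inr j \<Rightarrow> D $ i $ j))"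

definition symplectic_form :: "real ^ ('n::finite + 'n) ^ ('n + 'n)"
  where "symplectic_form = block_matrix 0 (mat 1) (- mat 1) 0"

definition symplectic_matrix :: "real ^ ('n::finite + 'n) ^ ('n + 'n) \<Rightarrow> bool"
  where "symplectic_matrix S \<longleftrightarrow> transpose S ** symplectic_form ** S = symplectic_form"

definition diag_matrix :: "('n::finite \<Rightarrow> real) \<Rightarrow> real ^ 'n ^ 'n"
  where "diag_matrix d = (\<chi> i j. if i = j then d i else 0)"

definition hyperbolic_matrix :: "real ^ 'n \<Rightarrow> real ^ ('n::finite + 'n) ^ ('n + 'n)"
  where "hyperbolic_matrix \<theta> =
    (let Ch = diag_matrix (\<lambda>i. cosh (\<theta> $ i)); Sh = diag_matrix (\<lambda>i. sinh (\<theta> $ i))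
     in block_matrix Ch Sh Sh Ch)"

definition hyperbolic_decomposition ::
  "real ^ ('n::finite + 'n) ^ ('n + 'n) \<Rightarrow> real ^ ('n + 'n) ^ ('n + 'n) \<Rightarrow> real ^ 'n
     \<Rightarrow> real ^ 'n ^ 'n \<Rightarrow> bool"
  where "hyperbolic_decomposition S U \<theta> G \<longleftrightarrow>
    orthogonal_matrix U \<and> symplectic_matrix U \<and> invertible G \<and>
    S = U ** hyperbolic_matrix \<theta> ** block_matrix G 0 0 (transpose (matrix_inv G))"

definition eq_up_to_order_and_signs :: "real ^ 'n \<Rightarrow> real ^ 'n \<Rightarrow> bool"
  where "eq_up_to_order_and_signs \<theta> \<theta>' \<longleftrightarrow>
    (\<exists>p \<epsilon>. bij p \<and> (\<forall>i. \<epsilon> i \<in> {1, -1}) \<and> (\<forall>i. \<theta>' $ i = \<epsilon> i * \<theta> $ p i))"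

end

theory Submission
  imports Defs "HOL-Combinatorics.Permutations" "HOL-Computational_Algebra.Polynomial"
begin

text \<open>
  Write \<open>S\<^sup>T S\<close> in blocks \<open>A, B, B\<^sup>T, D\<close>. A decomposition of \<open>S\<close> forces
  \<open>A = G\<^sup>T cosh(2\<theta>) G\<close> and \<open>B = G\<^sup>T sinh(2\<theta>) G\<^sup>-\<^sup>T\<close>, so the numbers \<open>sinh (2\<theta>\<^sub>i)\<close> are the roots of the
  characteristic polynomial of \<open>B\<close>, which gives uniqueness (even of the signs).
  Conversely, since \<open>S\<^sup>T S\<close> is symplectic, \<open>B\<^sup>T\<close> is self-adjoint for the inner product
  given by the positive definite matrix \<open>A\<close>, and \<open>A D = I + B\<^sup>2\<close>. An \<open>A\<close>-orthonormal eigenbasis \<open>P\<close> of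
  \<open>B\<^sup>T\<close> yields \<open>G\<^sup>-\<^sup>1 = P sqrt(cosh(2\<theta>))\<close>, and \<open>U\<close> is obtained by cancelling the other two
  factors; it is orthogonal because they already account for all of \<open>S\<^sup>T S\<close>.
\<close>

section \<open>Spectral theorem for the inner product given by a positive definite matrix\<close>

text \<open>Along the line \<open>x + t *\<^sub>R y\<close> the form is a quadratic in
  \<open>t\<close> without constant term; it can stay nonnegative only if its linear coefficient
  vanishes.\<close>

lemma quadratic_form_nonneg_zero:
  fixes Q :: "real ^ 'n ^ 'n"
  assumes sym: "transpose Q = Q" and W: "subspace W"
    and nonneg: "\<And>y. y \<in> W \<Longrightarrow> 0 \<le> y \<bullet> (Q *v y)"
    and x: "x \<in> W" "x \<bullet> (Q *v x) = 0" and y: "y \<in> W"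
  shows "y \<bullet> (Q *v x) = 0"
proof -
  define b c where "b = y \<bullet> (Q *v x)" and "c = y \<bullet> (Q *v y)"
  have "x \<bullet> (Q *v y) = b"
    unfolding b_def by (metis dot_lmul_matrix inner_commute sym transpose_matrix_vector)
  then have expand: "(x + t *\<^sub>R y) \<bullet> (Q *v (x + t *\<^sub>R y)) = 2 * t * b + t\<^sup>2 * c" for t
    using x(2) by (simp add: b_def c_def matrix_vector_right_distrib matrix_vector_mult_scaleR
        inner_add_left inner_add_right power2_eq_square algebra_simps)
  have c: "c \<ge> 0" using nonneg[OF y] by (simp add: c_def)
  \<comment> \<open>The test value is \<open>t = - b / (c + 1)\<close>, near the minimiser
    \<open>- b / c\<close> but still defined when \<open>c = 0\<close>.\<close>
  have "0 \<le> 2 * (- b / (c + 1)) * b + (- b / (c + 1))\<^sup>2 * c"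
    unfolding expand[symmetric] by (intro nonneg subspace_add subspace_scale W x y)
  also have "\<dots> = - (b\<^sup>2 * (c + 2)) / (c + 1)\<^sup>2"
    using c by (simp add: divide_simps) (simp add: power2_eq_square algebra_simps)
  finally have "b\<^sup>2 * (c + 2) \<le> 0"
    using c by (simp add: zero_le_divide_iff divide_le_0_iff)
  then show ?thesis
    using c by (simp add: b_def mult_le_0_iff)
qed

text \<open>Symmetry of \<open>A ** T\<close> says that \<open>T\<close> is self-adjoint for the
  inner product \<open>x \<bullet> (A *v y)\<close>. A maximiser of the Rayleigh quotient on the
  unit sphere of the invariant subspace \<open>W\<close> is then an eigenvector.\<close>

lemma selfadjoint_eigenvector_exists:
  fixes A T :: "real ^ 'n ^ 'n"
  assumes A: "transpose A = A" "\<And>x. x \<noteq> 0 \<Longrightarrow> 0 < x \<bullet> (A *v x)"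
    and AT: "transpose (A ** T) = A ** T"
    and W: "subspace W" "\<And>x. x \<in> W \<Longrightarrow> T *v x \<in> W" "W \<noteq> {0}"
  obtains x l where "x \<in> W" "x \<bullet> (A *v x) = 1" "T *v x = l *\<^sub>R x"
proof -
  define f where "f x = (x \<bullet> ((A ** T) *v x)) / (x \<bullet> (A *v x))" for x
  have nz: "x \<bullet> (A *v x) \<noteq> 0" if "x \<noteq> 0" for x
    using A(2)[OF that] by simp
  let ?K = "sphere 0 1 \<inter> W"
  have "compact ?K"
    by (intro compact_Int_closed compact_sphere closed_subspace W)
  moreover obtain w where w: "w \<in> W" "w \<noteq> 0"
    using W(1,3) subspace_0 by blast
  have "w /\<^sub>R norm w \<in> ?K"
    using w W(1) by (simp add: subspace_scale)
  then have "?K \<noteq> {}" by blast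
  moreover have "continuous_on ?K f"
    unfolding f_def by (intro continuous_intros matrix_vector_mult_linear_continuous_on) (auto intro!: nz)
  ultimately obtain x where x: "x \<in> ?K" and max: "\<And>y. y \<in> ?K \<Longrightarrow> f y \<le> f x"
    using continuous_attains_sup by metis
  have x0: "x \<noteq> 0" using x by auto
  define l where "l = f x"
  \<comment> \<open>\<open>l\<close> is the maximal Rayleigh quotient, so \<open>Q\<close> is positive semidefinite on \<open>W\<close> and vanishes at \<open>x\<close>.\<close>
  define Q where "Q = l *\<^sub>R A - A ** T"
  have Q_mult: "Q *v y = l *\<^sub>R (A *v y) - A *v (T *v y)" for y
    by (simp add: Q_def matrix_vector_mult_diff_rdistrib scaleR_matrix_vector_assoc matrix_vector_mul_assoc)
  have "transpose Q = Q"
    using A(1) AT by (simp add: Q_def vec_eq_iff transpose_def)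
  have nonneg: "0 \<le> y \<bullet> (Q *v y)" if "y \<in> W" for y
  proof (cases "y = 0")
    case False
    \<comment> \<open>The quotient is invariant under scaling, so its maximum on the sphere bounds
      it on all nonzero vectors of \<open>W\<close>.\<close>
    have "f (y /\<^sub>R norm y) \<le> l"
      unfolding l_def using that False W(1) by (intro max) (simp add: subspace_scale)
    moreover have "f (y /\<^sub>R norm y) = f y"
      using False by (simp add: f_def matrix_vector_mult_scaleR)
    ultimately show ?thesis
      using A(2)[OF False]
      by (simp add: f_def Q_mult inner_diff_right matrix_vector_mul_assoc divide_le_eq mult.commute)
  qed (simp)
  have "x \<bullet> (Q *v x) = 0"
    using nz[OF x0] by (simp add: Q_mult inner_diff_right l_def f_def matrix_vector_mul_assoc)
  \<comment> \<open>The defect of the eigenvector equation lies in \<open>W\<close> and satisfies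
    \<open>Q *v x = A *v z\<close>. Testing with \<open>z\<close> itself gives
    \<open>z \<bullet> (A *v z) = 0\<close>, and definiteness forces \<open>z = 0\<close>.\<close>
  define z where "z = l *\<^sub>R x - T *v x"
  have "z \<in> W"
    using x W by (simp add: z_def subspace_diff subspace_scale)
  then have "z \<bullet> (Q *v x) = 0"
    using quadratic_form_nonneg_zero[OF \<open>transpose Q = Q\<close> W(1) nonneg] x \<open>x \<bullet> (Q *v x) = 0\<close>
    by blast
  moreover have "Q *v x = A *v z"
    by (simp add: Q_mult z_def matrix_vector_mult_diff_distrib matrix_vector_mult_scaleR)
  ultimately have "z = 0"
    using nz by metis
  define r where "r = 1 / sqrt (x \<bullet> (A *v x))"
  show thesis
  proof (rule that)
    show "r *\<^sub>R x \<in> W" using x W(1) by (simp add: subspace_scale)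
    show "(r *\<^sub>R x) \<bullet> (A *v (r *\<^sub>R x)) = 1"
      using A(2)[OF x0] by (simp add: r_def matrix_vector_mult_scaleR)
    show "T *v (r *\<^sub>R x) = l *\<^sub>R (r *\<^sub>R x)"
      using \<open>z = 0\<close> by (metis z_def eq_iff_diff_eq_0 matrix_vector_mult_scaleR scaleR_left_commute)
  qed
qed

text \<open>Eigenvectors are collected one at a time: by self-adjointness, the
  \<open>A\<close>-orthogonal complement of those already found is invariant under \<open>T\<close>,
  so it contains a further one as long as it is nonzero.\<close>

lemma selfadjoint_eigenbasis_exists:
  fixes A T :: "real ^ 'n ^ 'n"
  assumes A: "transpose A = A" "\<And>x. x \<noteq> 0 \<Longrightarrow> 0 < x \<bullet> (A *v x)"
    and AT: "transpose (A ** T) = A ** T"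
  obtains E where "finite E" "card E = CARD('n)"
    "\<And>u. u \<in> E \<Longrightarrow> \<exists>l. T *v u = l *\<^sub>R u"
    "\<And>u v. u \<in> E \<Longrightarrow> v \<in> E \<Longrightarrow> u \<bullet> (A *v v) = (if u = v then 1 else 0)"
proof -
  let ?ok = "\<lambda>E. finite E \<and> (\<forall>u\<in>E. \<exists>l. T *v u = l *\<^sub>R u) \<and>
    (\<forall>u\<in>E. \<forall>v\<in>E. u \<bullet> (A *v v) = (if u = v then 1 else 0))"
  have A_commute: "x \<bullet> (A *v y) = y \<bullet> (A *v x)" for x y
    by (metis A(1) dot_lmul_matrix inner_commute transpose_matrix_vector)
  have T_adj: "x \<bullet> (A *v (T *v y)) = y \<bullet> (A *v (T *v x))" for x y
    by (metis AT dot_lmul_matrix inner_commute transpose_matrix_vector matrix_vector_mul_assoc)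
  have "k \<le> CARD('n) \<Longrightarrow> \<exists>E. ?ok E \<and> card E = k" for k
  proof (induction k)
    case 0
    then show ?case by (intro exI[of _ "{}"]) simp
  next
    case (Suc k)
    then obtain E where E: "?ok E" "card E = k" by auto
    define W where "W = {x. \<forall>u\<in>E. u \<bullet> (A *v x) = 0}"
    have "subspace W"
      by (auto simp: W_def subspace_def matrix_vector_right_distrib matrix_vector_mult_scaleR inner_add_right)
    moreover have "T *v x \<in> W" if "x \<in> W" for x
      unfolding W_def
    proof safe
      fix u assume "u \<in> E"
      then obtain l where "T *v u = l *\<^sub>R u" using E by blast
      then have "u \<bullet> (A *v (T *v x)) = l * (x \<bullet> (A *v u))"
        using T_adj[of u x] by (simp add: matrix_vector_mult_scaleR)
      then show "u \<bullet> (A *v (T *v x)) = 0"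
        using that \<open>u \<in> E\<close> by (simp add: W_def A_commute[of x])
    qed
    \<comment> \<open>Fewer than \<open>CARD('n)\<close> vectors \<open>A *v u\<close> span a proper
      subspace, and any vector orthogonal to it in the ordinary sense lies in
      \<open>W\<close>.\<close>
    moreover have "W \<noteq> {0}"
    proof -
      have "dim ((*v) A ` E) \<le> card ((*v) A ` E)"
        using E by (intro dim_le_card') auto
      also have "\<dots> \<le> k"
        using E card_image_le by blast
      finally have "dim ((*v) A ` E) < DIM(real ^ 'n)"
        using Suc.prems by simp
      then obtain x where "x \<noteq> 0" and x: "\<And>y. y \<in> span ((*v) A ` E) \<Longrightarrow> orthogonal x y"
        by (rule orthogonal_to_subspace_exists) blast
      have "x \<in> W"
        using x by (auto simp: W_def A_commute[of _ x] orthogonal_def span_base)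
      with \<open>x \<noteq> 0\<close> show ?thesis by blast
    qed
    ultimately obtain x l where x: "x \<in> W" "x \<bullet> (A *v x) = 1" "T *v x = l *\<^sub>R x"
      using selfadjoint_eigenvector_exists[OF A AT] by metis
    have "x \<notin> E" using x by (auto simp: W_def)
    moreover have "u \<bullet> (A *v x) = 0" "x \<bullet> (A *v u) = 0" if "u \<in> E" for u
      using x(1) that A_commute[of x u] by (simp_all add: W_def)
    with E x \<open>x \<notin> E\<close> have "?ok (insert x E)"
      by auto
    ultimately show ?case
      using E by (intro exI[of _ "insert x E"]) simp
  qed
  from this[OF order_refl] show thesis using that by blast
qed

section \<open>Diagonal matrices and simultaneous diagonalization\<close>

lemma diag_matrix_mult:
  "diag_matrix a ** diag_matrix b = diag_matrix (\<lambda>i. a i * b i)"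
proof -
  have "(\<Sum>k\<in>UNIV. (if i = k then a i else 0) * (if k = j then b k else 0)) =
      (\<Sum>k\<in>UNIV. if i = k then if k = j then a k * b k else 0 else 0)" for i j
    by (intro sum.cong) auto
  then show ?thesis
    by (simp add: diag_matrix_def matrix_matrix_mult_def vec_eq_iff)
qed

lemma transpose_diag_matrix [simp]: "transpose (diag_matrix d) = diag_matrix d"
  by (auto simp: diag_matrix_def transpose_def vec_eq_iff)

lemma diag_matrix_add: "diag_matrix a + diag_matrix b = diag_matrix (\<lambda>i. a i + b i)"
  by (simp add: diag_matrix_def vec_eq_iff)

lemma diag_matrix_1: "diag_matrix (\<lambda>i. 1) = mat 1"
  by (simp add: diag_matrix_def mat_def)

lemma diag_matrix_0: "diag_matrix (\<lambda>i. 0) = 0"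
  by (simp add: diag_matrix_def vec_eq_iff)

text \<open>With the \<open>A\<close>-orthonormal eigenvectors of \<open>T\<close> as the columns of
  \<open>P\<close>, the first identity is their Gram matrix and the second their eigenvalue
  equations.\<close>

lemma simultaneous_diagonalization:
  fixes A T :: "real ^ 'n ^ 'n"
  assumes A: "transpose A = A" "\<And>x. x \<noteq> 0 \<Longrightarrow> 0 < x \<bullet> (A *v x)"
    and AT: "transpose (A ** T) = A ** T"
  obtains P :: "real ^ 'n ^ 'n" and d where "transpose P ** A ** P = mat 1" "T ** P = P ** diag_matrix d"
proof -
  obtain E where E: "finite E" "card E = CARD('n)"
    "\<And>u. u \<in> E \<Longrightarrow> \<exists>l. T *v u = l *\<^sub>R u"
    "\<And>u v. u \<in> E \<Longrightarrow> v \<in> E \<Longrightarrow> u \<bullet> (A *v v) = (if u = v then 1 else 0)"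
    using selfadjoint_eigenbasis_exists[OF A AT] by blast
  obtain e :: "'n \<Rightarrow> real ^ 'n" where e: "bij_betw e UNIV E"
    using E(1,2) finite_same_card_bij[of "UNIV :: 'n set" E] by auto
  then have eE: "e i \<in> E" for i
    by (auto simp: bij_betw_def)
  then have "\<exists>l. T *v e i = l *\<^sub>R e i" for i
    using E(3) by blast
  then obtain d where d: "\<And>i. T *v e i = d i *\<^sub>R e i"
    by metis
  define P :: "real ^ 'n ^ 'n" where "P = (\<chi> i j. e j $ i)"
  have P: "(X ** P) $ i $ j = (X *v e j) $ i" for X :: "real ^ 'n ^ 'n" and i j
    by (simp add: P_def matrix_matrix_mult_def matrix_vector_mult_def)
  have "(transpose P ** A ** P) $ i $ j = e i \<bullet> (A *v e j)" for i j
    unfolding matrix_mul_assoc[symmetric]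
    by (subst matrix_matrix_mult_def) (simp add: P inner_vec_def, simp add: P_def transpose_def)
  moreover have "e i = e j \<longleftrightarrow> i = j" for i j
    using e by (auto simp: bij_betw_def inj_eq)
  ultimately have "transpose P ** A ** P = mat 1"
    using E(4) eE by (simp add: vec_eq_iff mat_def)
  moreover have "T ** P = P ** diag_matrix d"
  proof -
    have "(P ** diag_matrix d) $ i $ j = e j $ i * d j" for i j
      by (simp add: P_def matrix_matrix_mult_def diag_matrix_def if_distrib cong: if_cong)
    then show ?thesis
      by (simp add: vec_eq_iff P d)
  qed
  ultimately show thesis by (rule that)
qed

section \<open>Block matrix algebra\<close>

lemma block_matrix_nth [simp]:
  "block_matrix A B C D $ Inl i $ Inl j = A $ i $ j"
  "block_matrix A B C D $ Inl i $ Inr j = B $ i $ j"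
  "block_matrix A B C D $ Inr i $ Inl j = C $ i $ j"
  "block_matrix A B C D $ Inr i $ Inr j = D $ i $ j"
  by (simp_all add: block_matrix_def)

lemma block_matrix_eq_iff [simp]:
  "block_matrix A B C D = block_matrix A' B' C' D' \<longleftrightarrow> A = A' \<and> B = B' \<and> C = C' \<and> D = D'"
  by (auto simp: vec_eq_iff split_sum_all)

lemma block_matrix_exhaust:
  obtains A B C D where "M = block_matrix A B C D"
proof
  show "M = block_matrix (\<chi> i j. M $ Inl i $ Inl j) (\<chi> i j. M $ Inl i $ Inr j)
      (\<chi> i j. M $ Inr i $ Inl j) (\<chi> i j. M $ Inr i $ Inr j)"
    by (simp add: vec_eq_iff split_sum_all)
qed

lemma block_matrix_mult:
  fixes A :: "'a::semiring_1 ^ 'n::finite ^ 'n"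
  shows "block_matrix A B C D ** block_matrix A' B' C' D' =
    block_matrix (A ** A' + B ** C') (A ** B' + B ** D') (C ** A' + D ** C') (C ** B' + D ** D')"
proof -
  have "(\<Sum>x\<in>UNIV. f x) = (\<Sum>i\<in>UNIV. f (Inl i)) + (\<Sum>i\<in>UNIV. f (Inr i))"
    for f :: "'n + 'n \<Rightarrow> 'a"
    unfolding UNIV_Plus_UNIV[symmetric] by (simp add: sum.Plus del: UNIV_Plus_UNIV)
  then show ?thesis
    by (simp add: vec_eq_iff split_sum_all matrix_matrix_mult_def)
qed

lemma transpose_block_matrix:
  "transpose (block_matrix A B C D) =
    block_matrix (transpose A) (transpose C) (transpose B) (transpose D)"
  by (simp add: vec_eq_iff split_sum_all transpose_def)

lemma block_matrix_mat: "block_matrix (mat 1) 0 0 (mat 1) = mat 1"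
  by (simp add: vec_eq_iff split_sum_all mat_def)

lemma uminus_matrix_mult: "(- X) ** Y = - (X ** Y)" "X ** (- Y) = - (X ** Y)"
  for X :: "'a::ring_1 ^ 'n ^ 'm"
  by (simp_all add: vec_eq_iff matrix_matrix_mult_def sum_negf)

lemma matrix_add_rdistrib: "(X + Y) ** Z = X ** Z + Y ** Z"
  for X Y :: "'a::semiring_1 ^ 'n ^ 'm"
  by (simp add: vec_eq_iff matrix_matrix_mult_def sum.distrib distrib_right)

lemma transpose_0 [simp]: "transpose 0 = 0"
  by (simp add: vec_eq_iff transpose_def)

section \<open>Symplectic matrices\<close>

lemma symplectic_block_iff:
  "symplectic_matrix (block_matrix A B C D) \<longleftrightarrow>
    transpose A ** C = transpose C ** A \<and> transpose A ** D - transpose C ** B = mat 1 \<and>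
    transpose B ** C - transpose D ** A = - mat 1 \<and> transpose B ** D = transpose D ** B"
  unfolding symplectic_matrix_def symplectic_form_def
  by (simp add: transpose_block_matrix block_matrix_mult uminus_matrix_mult)

lemma symplectic_mult:
  assumes "symplectic_matrix X" "symplectic_matrix Y"
  shows "symplectic_matrix (X ** Y)"
proof -
  have "transpose (X ** Y) ** symplectic_form ** (X ** Y) =
      transpose Y ** (transpose X ** symplectic_form ** X) ** Y"
    by (simp add: matrix_transpose_mul matrix_mul_assoc)
  with assms show ?thesis
    by (simp add: symplectic_matrix_def)
qed

lemma symplectic_form_square:
  "symplectic_form ** symplectic_form = (- mat 1 :: real ^ ('n::finite + 'n) ^ ('n + 'n))"
proof -
  have "block_matrix (- mat 1) 0 0 (- mat 1) = (- mat 1 :: real ^ ('n + 'n) ^ ('n + 'n))"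
    by (simp add: vec_eq_iff split_sum_all mat_def)
  then show ?thesis
    by (simp add: symplectic_form_def block_matrix_mult)
qed

text \<open>Since \<open>J ** J = - mat 1\<close>, the defining equation exhibits
  \<open>- J ** transpose S ** J\<close> as a left inverse of \<open>S\<close>. For square matrices
  it is also a right inverse, which rearranges to the claim. This makes
  \<open>transpose S ** S\<close> symplectic.\<close>

lemma symplectic_transpose:
  assumes "symplectic_matrix S"
  shows "symplectic_matrix (transpose S)"
proof -
  let ?J = symplectic_form
  have S: "transpose S ** ?J ** S = ?J"
    using assms by (simp add: symplectic_matrix_def)
  have "(- ?J ** transpose S ** ?J) ** S = - (?J ** (transpose S ** ?J ** S))"
    by (simp add: matrix_mul_assoc uminus_matrix_mult)
  also have "\<dots> = mat 1"
    by (simp add: S symplectic_form_square)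
  finally have "S ** (- ?J ** transpose S ** ?J) = mat 1"
    by (simp add: matrix_left_right_inverse)
  then have "S ** (- ?J ** transpose S ** ?J) ** ?J = ?J"
    by simp
  moreover have "S ** (- ?J ** transpose S ** ?J) ** ?J
      = - (S ** ?J ** transpose S ** (?J ** ?J))"
    by (simp add: matrix_mul_assoc uminus_matrix_mult)
  ultimately show ?thesis
    by (simp add: symplectic_matrix_def symplectic_form_square uminus_matrix_mult)
qed

text \<open>The hypothesis is a form of \<open>Y\<close> being the inverse transpose of
  \<open>X\<close> that avoids \<open>matrix_inv\<close>.\<close>

lemma symplectic_diag_blocks:
  assumes "transpose X ** Y = mat 1"
  shows "symplectic_matrix (block_matrix X 0 0 Y)"
proof -
  have "transpose Y ** X = mat 1"
    using arg_cong[OF assms, of transpose] by (simp add: matrix_transpose_mul)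
  with assms show ?thesis by (simp add: symplectic_block_iff)
qed

section \<open>The hyperbolic factor\<close>

lemma transpose_hyperbolic_matrix [simp]: "transpose (hyperbolic_matrix \<theta>) = hyperbolic_matrix \<theta>"
  by (simp add: hyperbolic_matrix_def Let_def transpose_block_matrix)

text \<open>These are the double-angle formulas, the source of the angles
  \<open>2 * \<theta> $ i\<close> in \<open>transpose S ** S\<close>.\<close>

lemma hyperbolic_matrix_square:
  "hyperbolic_matrix \<theta> ** hyperbolic_matrix \<theta> = hyperbolic_matrix (2 *\<^sub>R \<theta>)"
proof -
  have "cosh (2 * x) = cosh x * cosh x + sinh x * sinh x"
    "sinh (2 * x) = cosh x * sinh x + sinh x * cosh x" for x :: real
    by (simp_all add: cosh_double sinh_double power2_eq_square)
  then show ?thesis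
    by (simp add: hyperbolic_matrix_def Let_def block_matrix_mult diag_matrix_mult diag_matrix_add
        add.commute)
qed

lemma hyperbolic_matrix_inverse: "hyperbolic_matrix \<theta> ** hyperbolic_matrix (- \<theta>) = mat 1"
proof -
  have "cosh x * cosh x = 1 + sinh x * sinh x" for x :: real
    using hyperbolic_pythagoras[of x] by (simp add: power2_eq_square)
  then show ?thesis
    by (simp add: hyperbolic_matrix_def Let_def block_matrix_mult diag_matrix_mult diag_matrix_add
        block_matrix_mat diag_matrix_1 diag_matrix_0 mult.commute)
qed

lemma symplectic_hyperbolic: "symplectic_matrix (hyperbolic_matrix \<theta>)"
proof -
  let ?C = "diag_matrix (\<lambda>i. cosh (\<theta> $ i))" and ?S = "diag_matrix (\<lambda>i. sinh (\<theta> $ i))"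
  have "cosh x * cosh x = 1 + sinh x * sinh x" for x :: real
    using hyperbolic_pythagoras[of x] by (simp add: power2_eq_square)
  then have "?C ** ?C = mat 1 + ?S ** ?S"
    by (simp add: diag_matrix_mult diag_matrix_add diag_matrix_1[symmetric])
  then show ?thesis
    by (simp add: hyperbolic_matrix_def Let_def symplectic_block_iff diag_matrix_mult mult.commute)
qed

section \<open>Uniqueness of the hyperbolic angles\<close>

text \<open>The orthogonal factor cancels in \<open>transpose S ** S\<close>, leaving the squared
  hyperbolic factor between block diagonal ones. In the upper right block these act as a similarity,
  so the eigenvalues survive.\<close>

lemma hyperbolic_decomposition_upper_right_block:
  assumes dec: "hyperbolic_decomposition S U \<theta> G"
    and M: "transpose S ** S = block_matrix A B C D"
  shows "B = transpose G ** diag_matrix (\<lambda>i. sinh (2 * \<theta> $ i)) ** transpose (matrix_inv G)"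
proof -
  define H K where "H = hyperbolic_matrix \<theta>" and "K = block_matrix G 0 0 (transpose (matrix_inv G))"
  have "transpose U ** U = mat 1" and S: "S = U ** H ** K"
    using dec by (simp_all add: hyperbolic_decomposition_def orthogonal_matrix H_def K_def)
  have "transpose S ** S = transpose K ** (H ** (transpose U ** U) ** H) ** K"
    by (simp add: S matrix_transpose_mul matrix_mul_assoc H_def)
  also have "\<dots> = transpose K ** hyperbolic_matrix (2 *\<^sub>R \<theta>) ** K"
    by (simp add: \<open>transpose U ** U = mat 1\<close> H_def hyperbolic_matrix_square)
  finally show ?thesis
    unfolding M by (simp add: K_def hyperbolic_matrix_def Let_def transpose_block_matrix block_matrix_mult)
qed

text \<open>\<open>matrix_inv\<close> is defined by choice, so its value is identified by cancelling
  against the known inverse \<open>V\<close>.\<close>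

lemma matrix_inv_eq:
  fixes G V :: "'a::field ^ 'n ^ 'n"
  assumes "G ** V = mat 1"
  shows "matrix_inv G = V"
proof -
  have V: "G ** V = mat 1 \<and> V ** G = mat 1"
    using assms matrix_left_right_inverse by blast
  then have "matrix_inv G ** G = mat 1"
    unfolding matrix_inv_def by (rule someI2) simp
  then have "matrix_inv G ** (G ** V) = V"
    by (simp add: matrix_mul_assoc)
  then show ?thesis by (simp add: assms)
qed

lemma transpose_matrix_inv_mult:
  fixes G :: "real ^ 'n ^ 'n"
  assumes "invertible G"
  shows "transpose (matrix_inv G) ** transpose G = mat 1"
  using assms unfolding invertible_def by (metis matrix_inv_eq matrix_transpose_mul transpose_mat)

text \<open>Similar matrices have the same characteristic polynomial: scalar matrices commute with
  \<open>X\<close>, so the conjugation factors out.\<close>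

lemma det_minus_conjugate_diag:
  fixes X Y :: "real ^ 'n ^ 'n"
  assumes "Y ** X = mat 1" "X ** Y = mat 1"
  shows "det (mat x - X ** diag_matrix d ** Y) = (\<Prod>i\<in>UNIV. x - d i)"
proof -
  have "mat x - X ** diag_matrix d ** Y = X ** (mat x - diag_matrix d) ** Y"
  proof -
    have "mat x = x *\<^sub>R (mat 1 :: real ^ 'n ^ 'n)"
      by (simp add: vec_eq_iff mat_def)
    then have "X ** mat x ** Y = mat x"
      using assms(2) by (simp add: matrix_scalar_ac flip: scalar_matrix_assoc)
    moreover have "X ** (P - Q) ** Y = X ** P ** Y - X ** Q ** Y" for P Q :: "real ^ 'n ^ 'n"
      using matrix_add_ldistrib[of X P "- Q"] matrix_add_rdistrib[of "X ** P" "- (X ** Q)" Y]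
      by (simp add: uminus_matrix_mult)
    ultimately show ?thesis by simp
  qed
  moreover have "det X * det Y = 1"
    using assms(2) by (metis det_I det_mul)
  moreover have "det (mat x - diag_matrix d) = (\<Prod>i\<in>UNIV. x - d i)"
    by (subst det_diagonal) (simp_all add: mat_def diag_matrix_def)
  ultimately show ?thesis by (simp add: det_mul)
qed

text \<open>Equality at every point lifts to equality of polynomials. Their root multisets then
  agree, multiplicities included, which yields the permutation.\<close>

lemma bij_of_prod_linear_eq:
  fixes a b :: "'n::finite \<Rightarrow> 'a::{idom,ring_char_0}"
  assumes "\<And>x. (\<Prod>i\<in>UNIV. x - a i) = (\<Prod>i\<in>UNIV. x - b i)"
  obtains p where "bij p" "\<And>i. a i = b (p i)"
proof -
  have roots: "proots (\<Prod>i\<in>UNIV. [:- c i, 1:]) = image_mset c (mset_set UNIV)" for c :: "'n \<Rightarrow> 'a"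
    by (subst proots_prod) (simp_all add: sum_unfold_sum_mset)
  have "(\<Prod>i\<in>UNIV. [:- a i, 1:]) = (\<Prod>i\<in>UNIV. [:- b i, 1:])"
    using assms by (intro poly_eqI_degree poly_ext) (simp add: poly_prod)
  then have "image_mset a (mset_set UNIV) = image_mset b (mset_set UNIV)"
    by (simp flip: roots)
  then obtain p where "p permutes UNIV" "\<forall>x\<in>UNIV. a x = b (p x)"
    using image_mset_eq_implies_permutes[of UNIV a b] by auto
  then show thesis
    using that permutes_bij by blast
qed

lemma hyperbolic_decomposition_unique:
  assumes "hyperbolic_decomposition S U \<theta> G" "hyperbolic_decomposition S U' \<theta>' G'"
  shows "eq_up_to_order_and_signs \<theta> \<theta>'"
proof -
  obtain A B C D where M: "transpose S ** S = block_matrix A B C D"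
    by (rule block_matrix_exhaust)
  have charpoly: "det (mat x - B) = (\<Prod>i\<in>UNIV. x - sinh (2 * \<phi> $ i))"
    if dec: "hyperbolic_decomposition S V \<phi> F" for x V \<phi> F
  proof -
    have "invertible F" using dec by (simp add: hyperbolic_decomposition_def)
    then have "transpose (matrix_inv F) ** transpose F = mat 1"
      by (rule transpose_matrix_inv_mult)
    then show ?thesis
      unfolding hyperbolic_decomposition_upper_right_block[OF dec M]
      by (intro det_minus_conjugate_diag) (simp_all add: matrix_left_right_inverse)
  qed
  obtain p where "bij p" and p: "\<And>i. sinh (2 * \<theta>' $ i) = sinh (2 * \<theta> $ p i)"
    using charpoly[OF assms(1)] charpoly[OF assms(2)]
    by (metis (no_types) bij_of_prod_linear_eq[of "\<lambda>i. sinh (2 * \<theta>' $ i)" "\<lambda>i. sinh (2 * \<theta> $ i)"])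
  \<comment> \<open>Injectivity of \<open>sinh\<close> recovers each angle with its sign, so the
    constant sign 1 serves as witness below.\<close>
  have "\<theta>' $ i = \<theta> $ p i" for i
    using arg_cong[OF p[of i], of arsinh] by (simp add: arsinh_sinh_real)
  with \<open>bij p\<close> show ?thesis
    unfolding eq_up_to_order_and_signs_def by (intro exI[of _ p] exI[of _ "\<lambda>_. 1"]) simp
qed

section \<open>Existence of the decomposition\<close>

lemma hyperbolic_decomposition_exists:
  fixes S :: "real ^ ('n::finite + 'n) ^ ('n + 'n)"
  assumes S: "symplectic_matrix S"
  obtains U \<theta> G where "hyperbolic_decomposition S U \<theta> G"
proof -
  obtain S1 S2 S3 S4 where blocks: "S = block_matrix S1 S2 S3 S4"
    by (rule block_matrix_exhaust)
  define A B D where "A = transpose S1 ** S1 + transpose S3 ** S3"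
    and "B = transpose S1 ** S2 + transpose S3 ** S4"
    and "D = transpose S2 ** S2 + transpose S4 ** S4"
  have transpose_add: "transpose (X + Y) = transpose X + transpose Y" for X Y :: "real ^ 'n ^ 'n"
    by (simp add: transpose_def vec_eq_iff)
  have A_sym: "transpose A = A"
    by (simp add: A_def transpose_add matrix_transpose_mul)
  have M: "transpose S ** S = block_matrix A B (transpose B) D"
    by (simp add: blocks transpose_block_matrix block_matrix_mult A_def B_def D_def
        transpose_add matrix_transpose_mul)
  have "symplectic_matrix (transpose S ** S)"
    by (intro symplectic_mult symplectic_transpose S)
  \<comment> \<open>These are the first two conditions of \<open>symplectic_block_iff\<close> for
    the blocks \<open>A\<close>, \<open>B\<close>, \<open>transpose B\<close>,
    \<open>D\<close>.\<close>
  then have AB: "A ** transpose B = B ** A" and AD: "A ** D = mat 1 + B ** B"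
    by (auto simp: M symplectic_block_iff A_sym algebra_simps)
  \<comment> \<open>The form is the sum of the squared norms of \<open>S1 *v x\<close> and
    \<open>S3 *v x\<close>, and the symplectic relation recovers \<open>x\<close> from these two
    vectors, so they cannot both vanish.\<close>
  have A_pos: "0 < x \<bullet> (A *v x)" if "x \<noteq> 0" for x
  proof -
    have "transpose (transpose S1 ** S4 - transpose S3 ** S2) = mat 1"
      using S by (simp add: blocks symplectic_block_iff)
    then have "transpose S4 ** S1 - transpose S2 ** S3 = mat 1"
      by (simp add: transpose_def vec_eq_iff matrix_matrix_mult_def mult.commute)
    then have "x = transpose S4 *v (S1 *v x) - transpose S2 *v (S3 *v x)"
      by (metis matrix_vector_mul_assoc matrix_vector_mult_diff_rdistrib matrix_vector_mul_lid)
    with that have "S1 *v x \<noteq> 0 \<or> S3 *v x \<noteq> 0" by auto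
    moreover have "x \<bullet> (A *v x) = (S1 *v x) \<bullet> (S1 *v x) + (S3 *v x) \<bullet> (S3 *v x)"
      by (simp add: A_def matrix_vector_mult_add_rdistrib inner_add_right matrix_vector_mul_assoc[symmetric]
          dot_lmul_matrix inner_commute[of x] del: transpose_matrix_vector)
         (simp add: dot_lmul_matrix)
    ultimately show ?thesis
      by (auto intro: add_pos_nonneg add_nonneg_pos)
  qed
  have "transpose (A ** transpose B) = A ** transpose B"
    by (simp add: AB matrix_transpose_mul A_sym)
  from simultaneous_diagonalization[OF A_sym A_pos this]
  obtain P :: "real ^ 'n ^ 'n" and s
    where P: "transpose P ** A ** P = mat 1" and BP: "transpose B ** P = P ** diag_matrix s"
    by blast
  \<comment> \<open>The uniqueness argument dictates the choice: the eigenvalues of \<open>B\<close>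
    must be \<open>sinh (2 * \<theta> $ i)\<close>.\<close>
  define \<theta> :: "real ^ 'n" where "\<theta> = (\<chi> i. arsinh (s i) / 2)"
  define c where "c i = cosh (2 * \<theta> $ i)" for i
  have s: "s i = sinh (2 * \<theta> $ i)" for i
    by (simp add: \<theta>_def)
  have c: "c i > 0" for i by (simp add: c_def)
  define Rt Ri where "Rt = diag_matrix (\<lambda>i. sqrt (c i))" and "Ri = diag_matrix (\<lambda>i. 1 / sqrt (c i))"
  have R: "Rt ** Ri = mat 1" "Ri ** Rt = mat 1" "Rt ** Rt = diag_matrix c"
    using c less_imp_neq[OF c] by (simp_all add: Rt_def Ri_def diag_matrix_mult diag_matrix_1 less_imp_le)
  \<comment> \<open>Rescaling \<open>P\<close> by \<open>Rt\<close> turns the Gram matrix of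
    \<open>A\<close> from the identity into \<open>diag_matrix c\<close>. As
    \<open>transpose P ** A\<close> inverts \<open>P\<close>, \<open>G\<close> is the inverse of
    \<open>V\<close>.\<close>
  define G V where "G = Ri ** transpose P ** A" and "V = P ** Rt"
  have tG: "transpose G = A ** P ** Ri" and tV: "transpose V = Rt ** transpose P"
    by (simp_all add: G_def V_def Rt_def Ri_def matrix_transpose_mul A_sym matrix_mul_assoc)
  have "G ** V = Ri ** (transpose P ** A ** P) ** Rt"
    by (simp add: G_def V_def matrix_mul_assoc)
  then have GV: "G ** V = mat 1" by (simp add: P R)
  then have VG: "V ** G = mat 1" by (simp add: matrix_left_right_inverse)
  \<comment> \<open>\<open>L\<close> inverts the block diagonal factor of the decomposition. The
    four products computed next are the blocks of
    \<open>transpose L ** (transpose S ** S) ** L\<close>.\<close>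
  define L where "L = block_matrix V 0 0 (transpose G)"
  have VAV: "transpose V ** A ** V = diag_matrix c"
  proof -
    have "transpose V ** A ** V = Rt ** (transpose P ** A ** P) ** Rt"
      unfolding tV by (simp add: V_def matrix_mul_assoc)
    then show ?thesis by (simp add: P R)
  qed
  have GBV: "G ** transpose B ** V = diag_matrix s"
  proof -
    have "G ** transpose B ** V = Ri ** transpose P ** A ** (transpose B ** P) ** Rt"
      by (simp add: G_def V_def matrix_mul_assoc)
    also have "\<dots> = Ri ** (transpose P ** A ** P) ** diag_matrix s ** Rt"
      by (simp add: BP matrix_mul_assoc)
    also have "\<dots> = diag_matrix s"
      using less_imp_neq[OF c] by (simp add: P Ri_def Rt_def diag_matrix_mult)
    finally show ?thesis .
  qed
  have VBG: "transpose V ** B ** transpose G = diag_matrix s"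
    using arg_cong[OF GBV, of transpose] by (simp add: matrix_transpose_mul matrix_mul_assoc)
  \<comment> \<open>\<open>D\<close> is known only through \<open>A ** D = mat 1 + B ** B\<close>.
    Since \<open>G\<close> and its transpose each contribute a factor \<open>A\<close>, only
    \<open>A ** D ** A\<close> has to be diagonalized; its entries \<open>1 + s i * s i\<close>
    equal \<open>c i * c i\<close>.\<close>
  have GDG: "G ** D ** transpose G = diag_matrix c"
  proof -
    have BBA: "B ** B ** A = A ** transpose B ** transpose B"
      by (metis AB matrix_mul_assoc)
    have XBP: "X ** transpose B ** P = X ** P ** diag_matrix s" for X :: "real ^ 'n ^ 'n"
      by (metis BP matrix_mul_assoc)
    have ADA: "A ** D ** A = A + A ** transpose B ** transpose B"
      by (simp only: AD matrix_add_rdistrib BBA matrix_mul_lid)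
    have "transpose P ** (A ** D ** A) ** P =
        transpose P ** A ** P + transpose P ** A ** transpose B ** (transpose B ** P)"
      by (simp only: ADA matrix_add_ldistrib matrix_add_rdistrib matrix_mul_assoc)
    also have "transpose P ** A ** transpose B ** (transpose B ** P) =
        (transpose P ** A ** P) ** diag_matrix s ** diag_matrix s"
      by (simp only: XBP matrix_mul_assoc)
    finally have PADAP: "transpose P ** (A ** D ** A) ** P = diag_matrix (\<lambda>i. 1 + s i * s i)"
      by (simp add: P diag_matrix_1[symmetric] diag_matrix_mult diag_matrix_add)
    have "G ** D ** transpose G = Ri ** (transpose P ** (A ** D ** A) ** P) ** Ri"
      unfolding tG by (simp add: G_def matrix_mul_assoc)
    also have "\<dots> = diag_matrix (\<lambda>i. (1 + s i * s i) / c i)"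
      using c by (simp add: PADAP Ri_def diag_matrix_mult less_imp_le)
    also have "(\<lambda>i. (1 + s i * s i) / c i) = c"
    proof
      fix i
      have "1 + s i * s i = c i * c i"
        using hyperbolic_pythagoras[of "2 * \<theta> $ i"] by (simp add: s c_def power2_eq_square)
      then show "(1 + s i * s i) / c i = c i" using c[of i] by simp
    qed
    finally show ?thesis .
  qed
  let ?H = "hyperbolic_matrix \<theta>" and ?H' = "hyperbolic_matrix (- \<theta>)"
  have H: "?H ** ?H' = mat 1" "?H' ** ?H = mat 1"
    using hyperbolic_matrix_inverse[of \<theta>] by (simp_all add: matrix_left_right_inverse)
  have LML: "transpose L ** (transpose S ** S) ** L = ?H ** ?H"
    unfolding hyperbolic_matrix_square
    by (simp add: L_def M transpose_block_matrix block_matrix_mult VAV GBV VBG GDG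
        hyperbolic_matrix_def Let_def c_def[symmetric] s[symmetric])
  \<comment> \<open>This solves the desired factorization for \<open>U\<close>, with
    \<open>?H'\<close> as the inverse of \<open>?H\<close>; \<open>LML\<close> then makes it
    orthogonal.\<close>
  define U where "U = S ** L ** ?H'"
  have "transpose U ** U = ?H' ** (transpose L ** (transpose S ** S) ** L) ** ?H'"
    by (simp add: U_def matrix_transpose_mul matrix_mul_assoc)
  also have "\<dots> = (?H' ** ?H) ** (?H ** ?H')"
    unfolding LML by (simp only: matrix_mul_assoc)
  finally have "orthogonal_matrix U"
    by (simp add: orthogonal_matrix H)
  moreover have "symplectic_matrix U"
  proof -
    have "transpose V ** transpose G = mat 1"
      using arg_cong[OF GV, of transpose] by (simp add: matrix_transpose_mul)
    then show ?thesis
      unfolding U_def L_def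
      by (intro symplectic_mult S symplectic_diag_blocks symplectic_hyperbolic)
  qed
  moreover have "invertible G"
    using GV VG invertible_def by blast
  moreover have "S = U ** ?H ** block_matrix G 0 0 (transpose (matrix_inv G))"
  proof -
    have "transpose G ** transpose V = mat 1"
      using arg_cong[OF VG, of transpose] by (simp add: matrix_transpose_mul)
    then have "L ** block_matrix G 0 0 (transpose V) = mat 1"
      by (simp add: L_def block_matrix_mult VG block_matrix_mat)
    moreover have "U ** ?H ** block_matrix G 0 0 (transpose V) =
        S ** L ** (?H' ** ?H) ** block_matrix G 0 0 (transpose V)"
      by (simp add: U_def matrix_mul_assoc)
    ultimately show ?thesis
      by (simp add: H matrix_inv_eq[OF GV]) (metis matrix_mul_assoc matrix_mul_rid)
  qed
  ultimately show thesis
    using that unfolding hyperbolic_decomposition_def by blast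
qed

theorem theorem6p5:
  fixes S :: "real ^ ('n::finite + 'n) ^ ('n + 'n)"
  assumes "symplectic_matrix S"
  shows "\<exists>\<theta> :: real ^ 'n.
           (\<exists>U G. hyperbolic_decomposition S U \<theta> G) \<and>
           (\<forall>\<theta>' U' G'. hyperbolic_decomposition S U' \<theta>' G' \<longrightarrow> eq_up_to_order_and_signs \<theta> \<theta>')"
  using hyperbolic_decomposition_exists[OF assms] hyperbolic_decomposition_unique by metis

end
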